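(* Let $G$ and $H$ be graphs. If $G\cong_{\mathcal S_+}H$, then $G$ and $H$ have cospectral Laplacian matrices, and so do their complements $\overline G$ and $\overline H$.
   Context: Graphs are finite, simple and undirected. The Laplacian of a graph $G$ is $D-A_G$, where $D$ is the diagonal matrix of vertex degrees and $A_G$ is the adjacency matrix. Matrices are cospectral if they have the same multiset of eigenvalues. For vertices $x,y$ of the same graph, $\mathrm{rel}(x,y)$ denotes their relationship: equal, adjacent, or distinct non-adjacent. $\mathcal S_+$ is the cone of (Hermitian) positive semidefinite matrices. $G\cong_{\mathcal S_+}H$ means: there is $M\in\mathcal S_+$ with rows and columns indexed by $V_G\times V_H$ such that $\sum_{h,h'\in V_H}M_{gh,g'h'}=1$ for all $g,g'\in V_G$; $\sum_{g,g'\in V_G}M_{gh,g'h'}=1$ for all $h,h'\in V_H$; and $M_{gh,g'h'}=0$ whenever $\mathrm{rel}(g,g')\neq\mathrm{rel}(h,h')$. *)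

theory Defs
  imports
    "Graph_Theory.Pair_Digraph"
    "Jordan_Normal_Form.Char_Poly"
begin

text \<open>
  Finite simple undirected graphs are the library's \<open>pair_graph\<close>s: \<open>parcs G\<close> is a symmetric
  irreflexive relation on the finite set \<open>pverts G\<close>, each edge occurring as two opposite arcs.
  The vertex set may be empty.
\<close>

definition complement_graph :: "'a pair_pre_digraph \<Rightarrow> 'a pair_pre_digraph" where
  "complement_graph G =
     \<lparr> pverts = pverts G,
       parcs = {(x, y). x \<in> pverts G \<and> y \<in> pverts G \<and> x \<noteq> y \<and> (x, y) \<notin> parcs G} \<rparr>"

lemma pair_graph_complement_graph:
  assumes "pair_graph G"
  shows "pair_graph (complement_graph G)"
proof -
  interpret pair_graph G by fact
  have "parcs (complement_graph G) \<subseteq> pverts G \<times> pverts G"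
    by (auto simp: complement_graph_def)
  then have fin: "finite (parcs (complement_graph G))"
    using pair_finite_verts by (meson finite_SigmaI finite_subset)
  have sym: "(x, y) \<in> parcs G \<longleftrightarrow> (y, x) \<in> parcs G" for x y
    using pair_sym_arcs by (auto simp: symmetric_def sym_def)
  show ?thesis
    using fin pair_finite_verts sym
    by unfold_locales (auto simp: complement_graph_def symmetric_def sym_def)
qed

datatype relationship = Equal | Adjacent | Nonadjacent

definition rel :: "'a pair_pre_digraph \<Rightarrow> 'a \<Rightarrow> 'a \<Rightarrow> relationship" where
  "rel G x y = (if x = y then Equal else if (x, y) \<in> parcs G then Adjacent else Nonadjacent)"

text \<open>
  A matrix with rows and columns indexed by a finite set \<open>I\<close> is a function of two arguments,
  of which only the values on \<open>I\<close> matter.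
\<close>

definition psd_on :: "'i set \<Rightarrow> ('i \<Rightarrow> 'i \<Rightarrow> complex) \<Rightarrow> bool" where
  "psd_on I M \<longleftrightarrow>
     (\<forall>i\<in>I. \<forall>j\<in>I. M j i = cnj (M i j)) \<and>
     (\<forall>z :: 'i \<Rightarrow> complex. 0 \<le> Re (\<Sum>i\<in>I. \<Sum>j\<in>I. cnj (z i) * M i j * z j))"

definition psd_isomorphic :: "'a pair_pre_digraph \<Rightarrow> 'b pair_pre_digraph \<Rightarrow> bool"
    (infix "\<cong>\<^sub>S\<^sub>+" 50) where
  "G \<cong>\<^sub>S\<^sub>+ H \<longleftrightarrow>
     (\<exists>M :: 'a \<times> 'b \<Rightarrow> 'a \<times> 'b \<Rightarrow> complex.
        psd_on (pverts G \<times> pverts H) M \<and>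
        (\<forall>g\<in>pverts G. \<forall>g'\<in>pverts G. (\<Sum>h\<in>pverts H. \<Sum>h'\<in>pverts H. M (g, h) (g', h')) = 1) \<and>
        (\<forall>h\<in>pverts H. \<forall>h'\<in>pverts H. (\<Sum>g\<in>pverts G. \<Sum>g'\<in>pverts G. M (g, h) (g', h')) = 1) \<and>
        (\<forall>g\<in>pverts G. \<forall>g'\<in>pverts G. \<forall>h\<in>pverts H. \<forall>h'\<in>pverts H.
           rel G g g' \<noteq> rel H h h' \<longrightarrow> M (g, h) (g', h') = 0))"

definition laplacian :: "'a pair_pre_digraph \<Rightarrow> 'a \<Rightarrow> 'a \<Rightarrow> complex" where
  "laplacian G x y =
     (if x = y then of_nat (out_degree (with_proj G) x) else 0)
     - (if (x, y) \<in> parcs G then 1 else 0)"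

definition mat_of_list :: "'i list \<Rightarrow> ('i \<Rightarrow> 'i \<Rightarrow> 'c) \<Rightarrow> 'c mat" where
  "mat_of_list xs A = mat (length xs) (length xs) (\<lambda>(k, l). A (xs ! k) (xs ! l))"

text \<open>
  Eigenvalues with algebraic multiplicity. Reordering the index set is a similarity
  transformation and so does not affect them; \<open>cospectral\<close> refers to all orderings
  instead of choosing one.
\<close>

definition eigenvalues_mset :: "complex mat \<Rightarrow> complex multiset" where
  "eigenvalues_mset A = proots (char_poly A)"

definition cospectral ::
    "'i set \<Rightarrow> ('i \<Rightarrow> 'i \<Rightarrow> complex) \<Rightarrow> 'j set \<Rightarrow> ('j \<Rightarrow> 'j \<Rightarrow> complex) \<Rightarrow> bool" where
  "cospectral I A J B \<longleftrightarrow>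
     (\<forall>xs ys. distinct xs \<and> set xs = I \<and> distinct ys \<and> set ys = J \<longrightarrow>
        eigenvalues_mset (mat_of_list xs A) = eigenvalues_mset (mat_of_list ys B))"

end

theory Submission
  imports Defs "Jordan_Normal_Form.Schur_Decomposition"
begin

text \<open>
  Write \<open>M\<close> as the Gram matrix of vectors \<open>v\<^bsub>gh\<^esub>\<close>. The two sum conditions make every row sum and
  every column sum of the array \<open>(v\<^bsub>gh\<^esub>)\<close> the same unit vector \<open>s\<close>, and
  \<open>\<langle>v\<^bsub>gh\<^esub>, s\<rangle> = \<parallel>v\<^bsub>gh\<^esub>\<parallel>\<^sup>2\<close>. Pairing \<open>v\<^bsub>gh\<^esub>\<close> with the sum of all \<open>v\<^bsub>g'h'\<^esub>\<close> for which \<open>g'\<close> is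
  adjacent to \<open>g\<close> and \<open>h'\<close> to \<open>h\<close> shows that \<open>g\<close> and \<open>h\<close> have the same degree unless
  \<open>v\<^bsub>gh\<^esub> = 0\<close>. Expanding the squared norm of the \<open>(g, h)\<close> entry then gives
  \<open>L\<^sub>G V = V L\<^sub>H\<close> for the array \<open>V = (v\<^bsub>gh\<^esub>)\<close>, hence \<open>L\<^sub>G\<^sup>k V = V L\<^sub>H\<^sup>k\<close>; pairing with \<open>V\<close> turns
  this into the equality of the traces of all powers of \<open>L\<^sub>G\<close> and \<open>L\<^sub>H\<close>, which determine the spectra.
  The hypothesis is invariant under complementation of both graphs.
  Instead of the vectors themselves, the formal argument uses the columns of \<open>M\<close>: a vector
  \<open>z\<close> on which the form vanishes satisfies \<open>M z = 0\<close>.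
\<close>

section \<open>Spectra from traces of powers\<close>

text \<open>Equal power sums give equal sums of every polynomial over the two lists. The polynomial
  \<open>p\<close>, a multiple of a Lagrange basis polynomial, vanishes at all entries other than
  \<open>c\<close>, so its sum isolates the multiplicity of \<open>c\<close>; characteristic zero
  then makes \<open>of_nat\<close> injective.\<close>

lemma mset_eq_if_power_sums_eq:
  fixes xs ys :: "'a :: field_char_0 list"
  assumes power_sums: "\<And>k. (\<Sum>x\<leftarrow>xs. x ^ k) = (\<Sum>y\<leftarrow>ys. y ^ k)"
  shows "mset xs = mset ys"
proof (rule multiset_eqI)
  fix c
  define p where "p = (\<Prod>s\<in>set xs \<union> set ys - {c}. [:- s, 1:])"
  have poly_c: "poly p c \<noteq> 0"
    unfolding p_def poly_prod by (subst prod_zero_iff) auto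
  have poly_other: "poly p s = 0" if "s \<in> set xs \<union> set ys" "s \<noteq> c" for s
    unfolding p_def poly_prod using that by (subst prod_zero_iff) auto
  have poly_sum: "(\<Sum>z\<leftarrow>zs. poly p z) = (\<Sum>i\<le>degree p. coeff p i * (\<Sum>z\<leftarrow>zs. z ^ i))" for zs
    by (induction zs) (simp_all add: poly_altdef sum.distrib distrib_left)
  have count_sum: "(\<Sum>z\<leftarrow>zs. poly p z) = of_nat (count (mset zs) c) * poly p c"
    if "set zs \<subseteq> set xs \<union> set ys" for zs
    using that by (induction zs) (auto simp: poly_other algebra_simps)
  have "of_nat (count (mset xs) c) * poly p c = of_nat (count (mset ys) c) * poly p c"
    using count_sum[of xs] count_sum[of ys] poly_sum[of xs] poly_sum[of ys]
    by (simp add: power_sums)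
  then show "count (mset xs) c = count (mset ys) c"
    using poly_c by simp
qed

section \<open>Traces of matrix powers via Schur triangularization\<close>

definition mat_trace :: "'a :: comm_monoid_add mat \<Rightarrow> 'a" where
  "mat_trace A = (\<Sum>i<dim_row A. A $$ (i, i))"

lemma mat_trace_mult_comm:
  fixes A B :: "'a :: comm_semiring_0 mat"
  assumes "A \<in> carrier_mat n m" "B \<in> carrier_mat m n"
  shows "mat_trace (A * B) = mat_trace (B * A)"
proof -
  have "mat_trace (A * B) = (\<Sum>i<n. \<Sum>j<m. A $$ (i, j) * B $$ (j, i))"
    using assms by (auto simp: mat_trace_def scalar_prod_def atLeast0LessThan intro!: sum.cong)
  also have "\<dots> = (\<Sum>j<m. \<Sum>i<n. B $$ (j, i) * A $$ (i, j))"
    by (subst sum.swap) (simp add: mult.commute)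
  also have "\<dots> = mat_trace (B * A)"
    using assms by (auto simp: mat_trace_def scalar_prod_def atLeast0LessThan intro!: sum.cong)
  finally show ?thesis .
qed

text \<open>A nonzero term of the product needs \<open>i\<close> \<le> \<open>l\<close> \<le>
  \<open>j\<close>; together with \<open>j\<close> \<le> \<open>i\<close> only
  \<open>l = i = j\<close> survives.\<close>

lemma upper_triangular_mult_index:
  fixes A B :: "'a :: semiring_0 mat"
  assumes "A \<in> carrier_mat n n" "B \<in> carrier_mat n n"
    and "upper_triangular A" "upper_triangular B" "j \<le> i" "i < n"
  shows "(A * B) $$ (i, j) = (if i = j then A $$ (i, i) * B $$ (i, i) else 0)"
proof -
  have "A $$ (i, l) * B $$ (l, j) = (if l = i \<and> i = j then A $$ (i, i) * B $$ (i, i) else 0)"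
    if "l < n" for l
  proof -
    consider "l < i" | "j < l" | "l = i" "i = j"
      using \<open>j \<le> i\<close> by linarith
    then show ?thesis
      using assms that upper_triangularD[of A l i] upper_triangularD[of B j l] by cases auto
  qed
  then have "(\<Sum>l<n. A $$ (i, l) * B $$ (l, j)) =
      (\<Sum>l<n. if l = i \<and> i = j then A $$ (i, i) * B $$ (i, i) else 0)"
    by (intro sum.cong) auto
  also have "\<dots> = (if i = j then A $$ (i, i) * B $$ (i, i) else 0)"
    using assms by (cases "i = j") (auto simp: sum.delta)
  finally show ?thesis
    using assms by (simp add: scalar_prod_def atLeast0LessThan)
qed

lemma upper_triangular_pow:
  fixes A :: "'a :: semiring_1 mat"
  assumes A: "A \<in> carrier_mat n n" and "upper_triangular A"
  shows "upper_triangular (A ^\<^sub>m k) \<and> (\<forall>i<n. (A ^\<^sub>m k) $$ (i, i) = A $$ (i, i) ^ k)"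
proof (induction k)
  case 0
  then show ?case using A by auto
next
  case (Suc k)
  have "(A ^\<^sub>m k * A) $$ (i, j) = (if i = j then (A ^\<^sub>m k) $$ (i, i) * A $$ (i, i) else 0)"
    if "j \<le> i" "i < n" for i j
    using assms that Suc by (intro upper_triangular_mult_index) auto
  then show ?case
    using assms Suc by (auto simp: power_commutes)
qed

text \<open>Schur decomposition gives \<open>A = P * B * Q\<close> with \<open>Q * P\<close> the
  identity and \<open>B\<close> triangular with diagonal \<open>es\<close>. Cyclicity of the trace
  removes \<open>P\<close> and \<open>Q\<close>, and powers of \<open>B\<close> have the powers of
  \<open>es\<close> on the diagonal.\<close>

lemma mat_trace_pow_char_poly:
  fixes A :: "'a :: conjugatable_ordered_field mat"
  assumes A: "A \<in> carrier_mat n n"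
    and es: "char_poly A = (\<Prod>e\<leftarrow>es. [:- e, 1:])"
  shows "mat_trace (A ^\<^sub>m k) = (\<Sum>e\<leftarrow>es. e ^ k)"
proof -
  obtain B P Q where schur: "schur_decomposition A es = (B, P, Q)"
    by (cases "schur_decomposition A es")
  have wit: "similar_mat_wit A B P Q" and "upper_triangular B" and diag: "diag_mat B = es"
    using schur_decomposition[OF A es schur] by auto
  note carrier = similar_mat_witD2[OF A wit]
  have pow: "B ^\<^sub>m k \<in> carrier_mat n n"
    using carrier by simp
  have "mat_trace (A ^\<^sub>m k) = mat_trace (P * (B ^\<^sub>m k * Q))"
    using similar_mat_wit_pow_id[OF wit, of k] carrier pow by simp
  also have "\<dots> = mat_trace (B ^\<^sub>m k * Q * P)"
    using carrier pow by (intro mat_trace_mult_comm) auto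
  also have "B ^\<^sub>m k * Q * P = B ^\<^sub>m k"
    by (simp only: assoc_mult_mat[OF pow carrier(7,6)] carrier(2) right_mult_one_mat[OF pow])
  also have "mat_trace \<dots> = (\<Sum>i<n. B $$ (i, i) ^ k)"
    using upper_triangular_pow[of B n k] \<open>upper_triangular B\<close> carrier
    by (simp add: mat_trace_def)
  also have "\<dots> = (\<Sum>e\<leftarrow>es. e ^ k)"
    using carrier unfolding diag[symmetric] diag_mat_def
    by (simp add: sum_list_sum_nth atLeast0LessThan)
  finally show ?thesis .
qed

text \<open>The traces are the power sums of the eigenvalues. The case \<open>k = 0\<close> forces
  \<open>n = m\<close>.\<close>

lemma eigenvalues_mset_eq_if_mat_trace_pow_eq:
  assumes A: "A \<in> carrier_mat n n" and B: "B \<in> carrier_mat m m"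
    and trace: "\<And>k. mat_trace (A ^\<^sub>m k) = mat_trace (B ^\<^sub>m k)"
  shows "eigenvalues_mset A = eigenvalues_mset B"
proof -
  obtain as where as: "char_poly A = (\<Prod>a\<leftarrow>as. [:- a, 1:])"
    using char_poly_factorized[OF A] by blast
  obtain bs where bs: "char_poly B = (\<Prod>b\<leftarrow>bs. [:- b, 1:])"
    using char_poly_factorized[OF B] by blast
  have "mset as = mset bs"
    using trace mat_trace_pow_char_poly[OF A as] mat_trace_pow_char_poly[OF B bs]
    by (intro mset_eq_if_power_sums_eq) simp
  moreover have roots: "proots (\<Prod>c\<leftarrow>cs. [:- c, 1:]) = mset cs" for cs :: "complex list"
  proof (induction cs)
    case (Cons c cs)
    have "(\<Prod>c\<leftarrow>cs. [:- c, 1:]) \<noteq> (0 :: complex poly)"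
      by (auto simp: prod_list_zero_iff)
    then show ?case
      using Cons proots_mult[of "[:- c, 1:]" "\<Prod>c\<leftarrow>cs. [:- c, 1:]"] by simp
  qed simp
  ultimately show ?thesis
    by (simp add: eigenvalues_mset_def as bs)
qed

section \<open>Positive semidefinite forms\<close>

text \<open>Bracketed so that the entries of the vector \<open>M y\<close> occur as subterms and can
  be rewritten on their own.\<close>

definition sesq :: "'i set \<Rightarrow> ('i \<Rightarrow> 'i \<Rightarrow> complex) \<Rightarrow> ('i \<Rightarrow> complex) \<Rightarrow> ('i \<Rightarrow> complex) \<Rightarrow> complex" where
  "sesq I M x y = (\<Sum>i\<in>I. cnj (x i) * (\<Sum>j\<in>I. M i j * y j))"

lemma sesq_diff:
  "sesq I M (\<lambda>i. x i - y i) (\<lambda>i. x i - y i) =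
    sesq I M x x - sesq I M x y - sesq I M y x + sesq I M y y"
  by (simp add: sesq_def left_diff_distrib right_diff_distrib sum_subtractf)

lemma psd_on_hermitian:
  assumes "psd_on I M" "i \<in> I" "j \<in> I"
  shows "M j i = cnj (M i j)"
proof -
  have "\<forall>i\<in>I. \<forall>j\<in>I. M j i = cnj (M i j)"
    using assms(1) unfolding psd_on_def by (rule conjunct1)
  with assms(2,3) show ?thesis
    by blast
qed

lemma psd_on_nonneg:
  assumes "psd_on I M"
  shows "0 \<le> Re (sesq I M z z)"
proof -
  have "sesq I M z z = (\<Sum>i\<in>I. \<Sum>j\<in>I. cnj (z i) * M i j * z j)"
    by (simp add: sesq_def sum_distrib_left mult.assoc)
  moreover have "\<forall>z. 0 \<le> Re (\<Sum>i\<in>I. \<Sum>j\<in>I. cnj (z i) * M i j * z j)"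
    using assms unfolding psd_on_def by (rule conjunct2)
  ultimately show ?thesis
    by simp
qed

text \<open>The form is nonnegative at \<open>z + t w\<close> for \<open>w = M z\<close> and every real \<open>t\<close>, and its linear term
  in \<open>t\<close> is \<open>2 \<parallel>w\<parallel>\<^sup>2\<close>.\<close>

lemma psd_on_kernel:
  assumes "finite I" and psd: "psd_on I M" and z: "sesq I M z z = 0" and "i \<in> I"
  shows "(\<Sum>j\<in>I. M i j * z j) = 0"
proof -
  define w where "w i = (\<Sum>j\<in>I. M i j * z j)" for i
  define S where "S = (\<Sum>i\<in>I. (cmod (w i))\<^sup>2)"
  define Q where "Q = Re (sesq I M w w)"
  have Q: "0 \<le> Q"
    unfolding Q_def by (rule psd_on_nonneg[OF psd])
  have wz: "sesq I M w z = of_real S"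
    unfolding sesq_def S_def w_def[symmetric]
    by (simp add: mult.commute[of "cnj _"] complex_norm_square del: of_real_power)
  \<comment> \<open>Hermitian symmetry moves \<open>M\<close> from \<open>w\<close> to
    \<open>z\<close>, so this cross term equals \<open>S\<close> as well.\<close>
  have "sesq I M z w = (\<Sum>j\<in>I. (\<Sum>i\<in>I. cnj (z i) * M i j) * w j)"
    unfolding sesq_def by (simp add: sum_distrib_left sum_distrib_right mult.assoc) (rule sum.swap)
  also have "\<dots> = (\<Sum>j\<in>I. cnj (w j) * w j)"
  proof (rule sum.cong[OF refl])
    fix j assume "j \<in> I"
    then have "M i j = cnj (M j i)" if "i \<in> I" for i
      by (rule psd_on_hermitian[OF psd _ that])
    then have "(\<Sum>i\<in>I. cnj (z i) * M i j) = (\<Sum>i\<in>I. cnj (M j i * z i))"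
      by (intro sum.cong) (simp_all add: mult.commute)
    then show "(\<Sum>i\<in>I. cnj (z i) * M i j) * w j = cnj (w j) * w j"
      by (simp add: w_def)
  qed
  also have "\<dots> = of_real S"
    unfolding S_def by (simp add: mult.commute[of "cnj _"] complex_norm_square del: of_real_power)
  finally have zw: "sesq I M z w = of_real S" .
  have expand: "sesq I M (\<lambda>i. z i - of_real t * w i) (\<lambda>i. z i - of_real t * w i) =
      - 2 * of_real t * of_real S + of_real (t\<^sup>2) * sesq I M w w" for t
  proof -
    have "sesq I M (\<lambda>i. of_real t * w i) z = of_real t * sesq I M w z"
      and "sesq I M z (\<lambda>i. of_real t * w i) = of_real t * sesq I M z w"
      and "sesq I M (\<lambda>i. of_real t * w i) (\<lambda>i. of_real t * w i) = of_real (t\<^sup>2) * sesq I M w w"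
      unfolding sesq_def by (simp_all add: sum_distrib_left power2_eq_square mult_ac)
    then show ?thesis
      by (simp add: sesq_diff z wz zw)
  qed
  have nonneg: "0 \<le> - 2 * t * S + t\<^sup>2 * Q" for t
    using psd_on_nonneg[OF psd, of "\<lambda>i. z i - of_real t * w i"] unfolding expand Q_def by simp
  have "S = 0"
  proof (rule ccontr)
    assume "S \<noteq> 0"
    \<comment> \<open>Substituting \<open>S = t * (Q + 1)\<close> makes the quadratic strictly
      negative. The summand 1 keeps the denominator positive when \<open>Q = 0\<close>.\<close>
    define t where "t = S / (Q + 1)"
    have "S = t * (Q + 1)" "t \<noteq> 0"
      using Q \<open>S \<noteq> 0\<close> by (auto simp: t_def)
    then have "- 2 * t * S + t\<^sup>2 * Q = - (t\<^sup>2 * (Q + 2))"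
      by (simp add: algebra_simps power2_eq_square)
    moreover have "0 < t\<^sup>2 * (Q + 2)"
      using \<open>t \<noteq> 0\<close> Q by (intro mult_pos_pos) auto
    ultimately show False
      using nonneg[of t] by linarith
  qed
  then have "w i = 0"
    using \<open>finite I\<close> \<open>i \<in> I\<close> by (simp add: S_def sum_nonneg_eq_0_iff)
  then show ?thesis by (simp add: w_def)
qed

text \<open>In the Gram picture these are the coefficients of a combination, with weights
  \<open>c\<close>, of the vectors in row \<open>g\<close>; \<open>col_vec\<close> does the same for
  a column.\<close>

definition row_vec :: "'a \<Rightarrow> ('b \<Rightarrow> complex) \<Rightarrow> 'a \<times> 'b \<Rightarrow> complex" where
  "row_vec g c i = (if fst i = g then c (snd i) else 0)"

definition col_vec :: "'b \<Rightarrow> ('a \<Rightarrow> complex) \<Rightarrow> 'a \<times> 'b \<Rightarrow> complex" where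
  "col_vec h c i = (if snd i = h then c (fst i) else 0)"

lemma sum_row_vec:
  assumes "finite A" "g \<in> A"
  shows "(\<Sum>i\<in>A \<times> B. F i * row_vec g c i) = (\<Sum>q\<in>B. F (g, q) * c q)"
proof -
  have "(\<Sum>i\<in>A \<times> B. F i * row_vec g c i) =
      (\<Sum>q\<in>B. \<Sum>p\<in>A. if p = g then F (g, q) * c q else 0)"
    by (subst sum.swap) (auto simp: sum.cartesian_product row_vec_def intro!: sum.cong)
  then show ?thesis
    using assms by (simp add: sum.delta)
qed

lemma sum_col_vec:
  assumes "finite B" "h \<in> B"
  shows "(\<Sum>i\<in>A \<times> B. F i * col_vec h c i) = (\<Sum>p\<in>A. F (p, h) * c p)"
proof -
  have "(\<Sum>i\<in>A \<times> B. F i * col_vec h c i) =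
      (\<Sum>p\<in>A. \<Sum>q\<in>B. if q = h then F (p, h) * c p else 0)"
    by (auto simp: sum.cartesian_product col_vec_def intro!: sum.cong)
  then show ?thesis
    using assms by (simp add: sum.delta)
qed

section \<open>Intertwining relations\<close>

text \<open>The part of the hypothesis that does not mention adjacency. The orthogonality conditions
  come from pairs of which exactly one has relationship \<open>Equal\<close>.\<close>

locale psd_bistochastic =
  fixes A :: "'a set" and B :: "'b set" and M :: "'a \<times> 'b \<Rightarrow> 'a \<times> 'b \<Rightarrow> complex"
  assumes finite_rows: "finite A" and finite_cols: "finite B"
    and psd: "psd_on (A \<times> B) M"
    and row_sum: "g \<in> A \<Longrightarrow> g' \<in> A \<Longrightarrow> (\<Sum>h\<in>B. \<Sum>h'\<in>B. M (g, h) (g', h')) = 1"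
    and col_sum: "h \<in> B \<Longrightarrow> h' \<in> B \<Longrightarrow> (\<Sum>g\<in>A. \<Sum>g'\<in>A. M (g, h) (g', h')) = 1"
    and row_orthogonal:
      "g \<in> A \<Longrightarrow> h \<in> B \<Longrightarrow> h' \<in> B \<Longrightarrow> h \<noteq> h' \<Longrightarrow> M (g, h) (g, h') = 0"
    and col_orthogonal:
      "g \<in> A \<Longrightarrow> g' \<in> A \<Longrightarrow> h \<in> B \<Longrightarrow> g \<noteq> g' \<Longrightarrow> M (g, h) (g', h) = 0"
begin

lemma hermitian: "i \<in> A \<times> B \<Longrightarrow> j \<in> A \<times> B \<Longrightarrow> M j i = cnj (M i j)"
  by (rule psd_on_hermitian[OF psd])

lemma sum_mult_row_vec:
  "g \<in> A \<Longrightarrow> (\<Sum>j\<in>A \<times> B. M i j * row_vec g c j) = (\<Sum>q\<in>B. M i (g, q) * c q)"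
  by (rule sum_row_vec[OF finite_rows])

lemma sum_mult_col_vec:
  "h \<in> B \<Longrightarrow> (\<Sum>j\<in>A \<times> B. M i j * col_vec h c j) = (\<Sum>p\<in>A. M i (p, h) * c p)"
  by (rule sum_col_vec[OF finite_cols])

lemma sesq_row_vec:
  assumes "g \<in> A"
  shows "sesq (A \<times> B) M (row_vec g c) y =
    (\<Sum>q\<in>B. cnj (c q) * (\<Sum>j\<in>A \<times> B. M (g, q) j * y j))"
proof -
  have "cnj (row_vec g c i) = row_vec g (\<lambda>q. cnj (c q)) i" for i :: "'a \<times> 'b"
    by (simp add: row_vec_def)
  then show ?thesis
    unfolding sesq_def
    by (simp only: mult.commute[of "row_vec g _ _"] sum_row_vec[OF finite_rows assms] mult.commute[of "cnj _"])
qed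

lemma sesq_col_vec:
  assumes "h \<in> B"
  shows "sesq (A \<times> B) M (col_vec h c) y =
    (\<Sum>p\<in>A. cnj (c p) * (\<Sum>j\<in>A \<times> B. M (p, h) j * y j))"
proof -
  have "cnj (col_vec h c i) = col_vec h (\<lambda>q. cnj (c q)) i" for i :: "'a \<times> 'b"
    by (simp add: col_vec_def)
  then show ?thesis
    unfolding sesq_def
    by (simp only: mult.commute[of "col_vec h _ _"] sum_col_vec[OF finite_cols assms] mult.commute[of "cnj _"])
qed

text \<open>Stands in for equality of two combinations of Gram vectors: if their difference has norm
  zero, both pair equally with every Gram vector.\<close>

lemma kernel:
  assumes "sesq (A \<times> B) M (\<lambda>j. x j - y j) (\<lambda>j. x j - y j) = 0" and "i \<in> A \<times> B"
  shows "(\<Sum>j\<in>A \<times> B. M i j * x j) = (\<Sum>j\<in>A \<times> B. M i j * y j)"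
  using psd_on_kernel[OF _ psd assms] finite_rows finite_cols
  by (simp add: right_diff_distrib sum_subtractf)

lemma row_sum_weighted:
  assumes "g \<in> A" "h \<in> B"
  shows "(\<Sum>q\<in>B. M (g, h) (g, q) * c q) = M (g, h) (g, h) * c h"
proof -
  have "(\<Sum>q\<in>B. M (g, h) (g, q) * c q) = (\<Sum>q\<in>B. if q = h then M (g, h) (g, h) * c h else 0)"
    using assms row_orthogonal by (intro sum.cong) auto
  then show ?thesis
    using assms finite_cols by simp
qed

lemma col_sum_weighted:
  assumes "g \<in> A" "h \<in> B"
  shows "(\<Sum>p\<in>A. M (g, h) (p, h) * c p) = M (g, h) (g, h) * c g"
proof -
  have "(\<Sum>p\<in>A. M (g, h) (p, h) * c p) = (\<Sum>p\<in>A. if p = g then M (g, h) (g, h) * c g else 0)"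
    using assms col_orthogonal by (intro sum.cong) auto
  then show ?thesis
    using assms finite_rows by simp
qed

text \<open>By \<open>row_sum\<close>, all four terms in the expansion of the difference of two row
  sums are 1, so the difference has norm zero. Row \<open>g'\<close> may thus be replaced by row
  \<open>g\<close>, where orthogonality leaves only the diagonal entry.\<close>

lemma row_sum_eq_diag:
  assumes "g \<in> A" "h \<in> B" "g' \<in> A"
  shows "(\<Sum>q\<in>B. M (g, h) (g', q)) = M (g, h) (g, h)"
proof -
  have "sesq (A \<times> B) M (\<lambda>j. row_vec g' (\<lambda>_. 1) j - row_vec g (\<lambda>_. 1) j)
      (\<lambda>j. row_vec g' (\<lambda>_. 1) j - row_vec g (\<lambda>_. 1) j) = 0"
    using assms by (simp add: sesq_diff sesq_row_vec sum_mult_row_vec row_sum)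
  from kernel[OF this, of "(g, h)"] show ?thesis
    using assms row_sum_weighted[of g h "\<lambda>_. 1"] by (simp add: sum_mult_row_vec)
qed

lemma col_sum_eq_diag:
  assumes "g \<in> A" "h \<in> B" "h' \<in> B"
  shows "(\<Sum>p\<in>A. M (g, h) (p, h')) = M (g, h) (g, h)"
proof -
  have "sesq (A \<times> B) M (\<lambda>j. col_vec h' (\<lambda>_. 1) j - col_vec h (\<lambda>_. 1) j)
      (\<lambda>j. col_vec h' (\<lambda>_. 1) j - col_vec h (\<lambda>_. 1) j) = 0"
    using assms by (simp add: sesq_diff sesq_col_vec sum_mult_col_vec col_sum)
  from kernel[OF this, of "(g, h)"] show ?thesis
    using assms col_sum_weighted[of g h "\<lambda>_. 1"] by (simp add: sum_mult_col_vec)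
qed

text \<open>Together with \<open>sum_diag_col\<close>, this supplies the weights for comparing
  traces.\<close>

lemma sum_diag_row: "g \<in> A \<Longrightarrow> (\<Sum>h\<in>B. M (g, h) (g, h)) = 1"
  using row_sum[of g g] row_sum_weighted[of g _ "\<lambda>_. 1"] by simp

lemma sum_diag_col: "h \<in> B \<Longrightarrow> (\<Sum>g\<in>A. M (g, h) (g, h)) = 1"
  using col_sum[of h h] col_sum_weighted[of _ h "\<lambda>_. 1"] by simp

text \<open>Here \<open>x\<close> and \<open>y\<close> represent the \<open>(g, h)\<close> entries
  of \<open>K V\<close> and \<open>V L\<close>. Wherever the Gram entry is nonzero,
  \<open>K g p\<close> and \<open>L q h\<close> are interchangeable, so each cross term equals a
  square term and the difference has norm zero.\<close>

lemma intertwine: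
  fixes K :: "'a \<Rightarrow> 'a \<Rightarrow> complex" and L :: "'b \<Rightarrow> 'b \<Rightarrow> complex"
  assumes real: "\<And>g p. g \<in> A \<Longrightarrow> p \<in> A \<Longrightarrow> cnj (K g p) = K g p"
    "\<And>q h. q \<in> B \<Longrightarrow> h \<in> B \<Longrightarrow> cnj (L q h) = L q h"
    and compatible: "\<And>g p q h. g \<in> A \<Longrightarrow> p \<in> A \<Longrightarrow> q \<in> B \<Longrightarrow> h \<in> B \<Longrightarrow>
      K g p \<noteq> L q h \<Longrightarrow> M (p, h) (g, q) = 0"
    and mem: "i \<in> A \<times> B" "g \<in> A" "h \<in> B"
  shows "(\<Sum>p\<in>A. K g p * M i (p, h)) = (\<Sum>q\<in>B. M i (g, q) * L q h)"
proof -
  define x :: "'a \<times> 'b \<Rightarrow> complex" where "x = col_vec h (K g)"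
  define y :: "'a \<times> 'b \<Rightarrow> complex" where "y = row_vec g (\<lambda>q. L q h)"
  have xx: "sesq (A \<times> B) M x x = (\<Sum>p\<in>A. K g p * (M (p, h) (p, h) * K g p))"
    using mem real by (simp add: x_def sesq_col_vec sum_mult_col_vec col_sum_weighted)
  have yy: "sesq (A \<times> B) M y y = (\<Sum>q\<in>B. L q h * (M (g, q) (g, q) * L q h))"
    using mem real by (simp add: y_def sesq_row_vec sum_mult_row_vec row_sum_weighted)
  \<comment> \<open>Once \<open>L q h\<close> is exchanged for \<open>K g p\<close>, the weight no
    longer depends on \<open>q\<close> and the row sum collapses to the diagonal.\<close>
  have "(\<Sum>q\<in>B. M (p, h) (g, q) * L q h) = M (p, h) (p, h) * K g p" if "p \<in> A" for p
  proof -
    have "(\<Sum>q\<in>B. M (p, h) (g, q) * L q h) = (\<Sum>q\<in>B. M (p, h) (g, q) * K g p)"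
      using compatible[of g p _ h] mem that by (intro sum.cong) auto
    then show ?thesis
      using mem that row_sum_eq_diag[of p h g] by (simp flip: sum_distrib_right)
  qed
  then have xy: "sesq (A \<times> B) M x y = sesq (A \<times> B) M x x"
    unfolding xx using mem real by (simp add: x_def y_def sesq_col_vec sum_mult_row_vec)
  have "(\<Sum>p\<in>A. M (g, q) (p, h) * K g p) = M (g, q) (g, q) * L q h" if "q \<in> B" for q
  proof -
    have "(\<Sum>p\<in>A. M (g, q) (p, h) * K g p) = (\<Sum>p\<in>A. M (g, q) (p, h) * L q h)"
      using compatible[of g _ q h] mem that hermitian[of "(_, h)" "(g, q)"]
      by (intro sum.cong) auto
    then show ?thesis
      using mem that col_sum_eq_diag[of g q h] by (simp flip: sum_distrib_right)
  qed
  then have yx: "sesq (A \<times> B) M y x = sesq (A \<times> B) M y y"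
    unfolding yy using mem real by (simp add: x_def y_def sesq_row_vec sum_mult_col_vec)
  have "sesq (A \<times> B) M (\<lambda>j. x j - y j) (\<lambda>j. x j - y j) = 0"
    by (simp add: sesq_diff xy yx)
  from kernel[OF this mem(1)] show ?thesis
    using mem by (simp add: x_def y_def sum_mult_col_vec sum_mult_row_vec mult.commute)
qed

text \<open>The intertwining passes to powers. Its diagonal entries, weighted by the diagonal of
  \<open>M\<close>, add up to the traces of the powers on both sides.\<close>

lemma cospectral_if_intertwine:
  fixes K :: "'a \<Rightarrow> 'a \<Rightarrow> complex" and L :: "'b \<Rightarrow> 'b \<Rightarrow> complex"
  assumes intertwine: "\<And>i g h. i \<in> A \<times> B \<Longrightarrow> g \<in> A \<Longrightarrow> h \<in> B \<Longrightarrow>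
    (\<Sum>p\<in>A. K g p * M i (p, h)) = (\<Sum>q\<in>B. M i (g, q) * L q h)"
  shows "cospectral A K B L"
  unfolding cospectral_def
proof (intro allI impI, elim conjE)
  fix xs ys
  assume xs: "distinct xs" "set xs = A" and ys: "distinct ys" "set ys = B"
  define n m where "n = length xs" and "m = length ys"
  define C D where "C = mat_of_list xs K" and "D = mat_of_list ys L"
  \<comment> \<open>Row \<open>i\<close> of \<open>M\<close> reshaped into an array: the scalar
    version of \<open>V\<close>, paired entrywise with the Gram vector at \<open>i\<close>.\<close>
  define U where "U i = mat n m (\<lambda>(a, b). M i (xs ! a, ys ! b))" for i
  have C: "C \<in> carrier_mat n n" and D: "D \<in> carrier_mat m m" and U: "U i \<in> carrier_mat n m" for i
    by (simp_all add: C_def D_def U_def n_def m_def mat_of_list_def)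
  have sum_A: "(\<Sum>g\<in>A. f g) = (\<Sum>a<n. f (xs ! a))" for f :: "'a \<Rightarrow> complex"
    unfolding n_def using xs by (intro sum.reindex_bij_betw[symmetric] bij_betw_nth) auto
  have sum_B: "(\<Sum>h\<in>B. f h) = (\<Sum>b<m. f (ys ! b))" for f :: "'b \<Rightarrow> complex"
    unfolding m_def using ys by (intro sum.reindex_bij_betw[symmetric] bij_betw_nth) auto
  have mem_A: "xs ! a \<in> A" if "a < n" for a
    using that xs n_def by auto
  have mem_B: "ys ! b \<in> B" if "b < m" for b
    using that ys m_def by auto
  have CU: "C * U i = U i * D" if "i \<in> A \<times> B" for i
  proof (rule eq_matI)
    fix a b assume "a < dim_row (U i * D)" "b < dim_col (U i * D)"
    then have "a < n" "b < m"
      using U[of i] D by auto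
    then show "(C * U i) $$ (a, b) = (U i * D) $$ (a, b)"
      using intertwine[OF that mem_A mem_B, of a b]
      by (simp add: C_def D_def U_def mat_of_list_def n_def[symmetric] m_def[symmetric]
          scalar_prod_def atLeast0LessThan sum_A sum_B)
  qed (use C D U[of i] in auto)
  have pow_U: "C ^\<^sub>m k * U i = U i * D ^\<^sub>m k" if "i \<in> A \<times> B" for i k
  proof (induction k)
    case 0
    then show ?case
      using C D U[of i] by simp
  next
    case (Suc k)
    have pows: "C ^\<^sub>m k \<in> carrier_mat n n" "D ^\<^sub>m k \<in> carrier_mat m m"
      using C D by simp_all
    have "C ^\<^sub>m Suc k * U i = C ^\<^sub>m k * (U i * D)"
      using assoc_mult_mat[OF pows(1) C U[of i]] CU[OF that] by simp
    also have "\<dots> = U i * D ^\<^sub>m k * D"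
      using assoc_mult_mat[OF pows(1) U[of i] D] Suc by simp
    also have "\<dots> = U i * D ^\<^sub>m Suc k"
      using assoc_mult_mat[OF U[of i] pows(2) D] by simp
    finally show ?case .
  qed
  have "mat_trace (C ^\<^sub>m k) = mat_trace (D ^\<^sub>m k)" for k
  proof -
    define d where "d a b = M (xs ! a, ys ! b) (xs ! a, ys ! b)" for a b
    have pows: "C ^\<^sub>m k \<in> carrier_mat n n" "D ^\<^sub>m k \<in> carrier_mat m m"
      using C D by simp_all
    have entry: "(C ^\<^sub>m k) $$ (a, a) * d a b = d a b * (D ^\<^sub>m k) $$ (b, b)"
      if "a < n" "b < m" for a b
    proof -
      \<comment> \<open>With this \<open>i\<close>, column \<open>b\<close> and row \<open>a\<close>
        of \<open>U i\<close> vanish except at \<open>(a, b)\<close>, so each matrix product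
        contributes one term.\<close>
      let ?i = "(xs ! a, ys ! b)"
      have col_zero: "M ?i (xs ! l, ys ! b) = 0" if "l < n" "l \<noteq> a" for l
        using that \<open>a < n\<close> \<open>b < m\<close> xs n_def
        by (intro col_orthogonal mem_A mem_B) (simp_all add: nth_eq_iff_index_eq)
      have row_zero: "M ?i (xs ! a, ys ! l) = 0" if "l < m" "l \<noteq> b" for l
        using that \<open>a < n\<close> \<open>b < m\<close> ys m_def
        by (intro row_orthogonal mem_A mem_B) (simp_all add: nth_eq_iff_index_eq)
      have "(C ^\<^sub>m k * U ?i) $$ (a, b) =
          (\<Sum>l<n. (C ^\<^sub>m k) $$ (a, l) * M ?i (xs ! l, ys ! b))"
        using that pows C D by (simp add: U_def scalar_prod_def atLeast0LessThan)
      also have "\<dots> = (\<Sum>l<n. if l = a then (C ^\<^sub>m k) $$ (a, a) * d a b else 0)"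
        using col_zero by (intro sum.cong refl) (auto simp: d_def)
      finally have left: "(C ^\<^sub>m k * U ?i) $$ (a, b) = (C ^\<^sub>m k) $$ (a, a) * d a b"
        using that by simp
      have "(U ?i * D ^\<^sub>m k) $$ (a, b) =
          (\<Sum>l<m. M ?i (xs ! a, ys ! l) * (D ^\<^sub>m k) $$ (l, b))"
        using that pows C D by (simp add: U_def scalar_prod_def atLeast0LessThan)
      also have "\<dots> = (\<Sum>l<m. if l = b then d a b * (D ^\<^sub>m k) $$ (b, b) else 0)"
        using row_zero by (intro sum.cong refl) (auto simp: d_def)
      finally have "(U ?i * D ^\<^sub>m k) $$ (a, b) = d a b * (D ^\<^sub>m k) $$ (b, b)"
        using that by simp
      moreover have "C ^\<^sub>m k * U ?i = U ?i * D ^\<^sub>m k"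
        using that by (intro pow_U) (simp add: mem_A mem_B)
      ultimately show ?thesis
        using left by metis
    qed
    have row: "(\<Sum>b<m. d a b) = 1" if "a < n" for a
      using sum_diag_row[OF mem_A[OF that]] by (simp add: d_def sum_B)
    have col: "(\<Sum>a<n. d a b) = 1" if "b < m" for b
      using sum_diag_col[OF mem_B[OF that]] by (simp add: d_def sum_A)
    \<comment> \<open>Inserting the row sums of \<open>d\<close>, which are 1, makes
      \<open>entry\<close> applicable; the column sums then remove \<open>d\<close> again.\<close>
    have "mat_trace (C ^\<^sub>m k) = (\<Sum>a<n. (C ^\<^sub>m k) $$ (a, a) * (\<Sum>b<m. d a b))"
      using C pows row by (simp add: mat_trace_def)
    also have "\<dots> = (\<Sum>a<n. \<Sum>b<m. d a b * (D ^\<^sub>m k) $$ (b, b))"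
      by (simp add: sum_distrib_left entry)
    also have "\<dots> = (\<Sum>b<m. (\<Sum>a<n. d a b) * (D ^\<^sub>m k) $$ (b, b))"
      by (subst sum.swap) (simp add: sum_distrib_right)
    also have "\<dots> = mat_trace (D ^\<^sub>m k)"
      using D pows col by (simp add: mat_trace_def)
    finally show ?thesis .
  qed
  then show "eigenvalues_mset (mat_of_list xs K) = eigenvalues_mset (mat_of_list ys L)"
    using eigenvalues_mset_eq_if_mat_trace_pow_eq[OF C D] by (simp add: C_def D_def)
qed

end

section \<open>Graphs\<close>

lemma out_degree_eq_sum:
  assumes "pair_graph G"
  shows "(of_nat (out_degree (with_proj G) x) :: complex) =
    (\<Sum>y\<in>pverts G. if (x, y) \<in> parcs G then 1 else 0)"
proof -
  interpret pair_graph G by fact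
  have "out_arcs (with_proj G) x = Pair x ` {y \<in> pverts G. (x, y) \<in> parcs G}"
    by (auto simp: out_arcs_def dest: in_arcsD2)
  then have "out_degree (with_proj G) x = card {y \<in> pverts G. (x, y) \<in> parcs G}"
    by (simp add: out_degree_def card_image inj_on_def)
  then show ?thesis
    by (simp add: sum.If_cases Int_def)
qed

lemma pair_graph_arcs_sym:
  assumes "pair_graph G"
  shows "(x, y) \<in> parcs G \<longleftrightarrow> (y, x) \<in> parcs G"
proof -
  interpret pair_graph G by fact
  show ?thesis
    using pair_sym_arcs by (auto simp: symmetric_def sym_def)
qed

lemma pair_graph_no_loop:
  assumes "pair_graph G"
  shows "(x, x) \<notin> parcs G"
proof -
  interpret pair_graph G by fact
  show ?thesis
    using pair_no_loops by fastforce
qed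

section \<open>Complementation\<close>

lemma rel_complement_graph:
  assumes "x \<in> pverts G" "y \<in> pverts G"
  shows "rel (complement_graph G) x y =
    (case rel G x y of Equal \<Rightarrow> Equal | Adjacent \<Rightarrow> Nonadjacent | Nonadjacent \<Rightarrow> Adjacent)"
  using assms by (simp add: rel_def complement_graph_def)

text \<open>The same \<open>M\<close> is a witness: complementation swaps adjacency and
  non-adjacency in both graphs at once, so pairs whose relationships differ in the complements
  already differ in \<open>G\<close> and \<open>H\<close>.\<close>

lemma psd_isomorphic_complement_graph:
  assumes "G \<cong>\<^sub>S\<^sub>+ H"
  shows "complement_graph G \<cong>\<^sub>S\<^sub>+ complement_graph H"
proof -
  have rel: "rel G g g' = rel H h h'
      \<Longrightarrow> rel (complement_graph G) g g' = rel (complement_graph H) h h'"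
    if "g \<in> pverts G" "g' \<in> pverts G" "h \<in> pverts H" "h' \<in> pverts H" for g g' h h'
    using that by (simp add: rel_complement_graph)
  have verts: "pverts (complement_graph G) = pverts G" "pverts (complement_graph H) = pverts H"
    by (simp_all add: complement_graph_def)
  show ?thesis
    using assms unfolding psd_isomorphic_def verts
    by (elim exE conjE, intro exI conjI) (assumption+, use rel in blast)
qed

text \<open>Only compatibility of the two Laplacians with \<open>M\<close> needs graph theory.
  Off-diagonal entries are determined by \<open>rel\<close>; diagonal ones need equal degrees
  wherever \<open>M\<close> has a nonzero diagonal entry.\<close>

lemma cospectral_laplacian:
  assumes G: "pair_graph G" and H: "pair_graph H" and iso: "G \<cong>\<^sub>S\<^sub>+ H"
  shows "cospectral (pverts G) (laplacian G) (pverts H) (laplacian H)"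
proof -
  obtain M where M: "psd_on (pverts G \<times> pverts H) M"
    "\<And>g g'. g \<in> pverts G \<Longrightarrow> g' \<in> pverts G \<Longrightarrow>
      (\<Sum>h\<in>pverts H. \<Sum>h'\<in>pverts H. M (g, h) (g', h')) = 1"
    "\<And>h h'. h \<in> pverts H \<Longrightarrow> h' \<in> pverts H \<Longrightarrow>
      (\<Sum>g\<in>pverts G. \<Sum>g'\<in>pverts G. M (g, h) (g', h')) = 1"
    and M_rel: "\<And>g g' h h'. g \<in> pverts G \<Longrightarrow> g' \<in> pverts G \<Longrightarrow> h \<in> pverts H \<Longrightarrow> h' \<in> pverts H \<Longrightarrow>
      rel G g g' \<noteq> rel H h h' \<Longrightarrow> M (g, h) (g', h') = 0"
    using iso unfolding psd_isomorphic_def by blast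
  have fin: "finite (pverts G)" "finite (pverts H)"
    using G H by (auto simp: pair_graph_def pair_digraph_def intro: pair_fin_digraph.pair_finite_verts)
  interpret psd_bistochastic "pverts G" "pverts H" M
    using fin M M_rel by unfold_locales (auto simp: rel_def split: if_splits)
  note no_loop = pair_graph_no_loop[OF G] pair_graph_no_loop[OF H]
  \<comment> \<open>Double counting: the sum of \<open>M (g, h) (p, q)\<close> over neighbours
    \<open>p\<close> of \<open>g\<close> and all \<open>q\<close> is the degree of \<open>g\<close>
    times the diagonal entry. Its support also has \<open>q\<close> adjacent to \<open>h\<close>, so
    the same sum gives the degree of \<open>h\<close>.\<close>
  have degree: "out_degree (with_proj G) g = out_degree (with_proj H) h"
    if "g \<in> pverts G" "h \<in> pverts H" "M (g, h) (g, h) \<noteq> 0" for g h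
  proof -
    define a :: "_ \<Rightarrow> complex" where "a p = (if (g, p) \<in> parcs G then 1 else 0)" for p
    define b :: "_ \<Rightarrow> complex" where "b q = (if (h, q) \<in> parcs H then 1 else 0)" for q
    have ab: "M (g, h) (p, q) * a p = M (g, h) (p, q) * b q"
      if "p \<in> pverts G" "q \<in> pverts H" for p q
    proof (cases "a p = b q")
      case False
      then have "rel G g p \<noteq> rel H h q"
        using no_loop by (auto simp: a_def b_def rel_def split: if_splits)
      then show ?thesis
        using M_rel \<open>g \<in> _\<close> \<open>h \<in> _\<close> that by simp
    qed simp
    have "M (g, h) (g, h) * (\<Sum>p\<in>pverts G. a p) =
        (\<Sum>p\<in>pverts G. (\<Sum>q\<in>pverts H. M (g, h) (p, q)) * a p)"
      using that by (simp add: row_sum_eq_diag sum_distrib_left)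
    also have "\<dots> = (\<Sum>p\<in>pverts G. \<Sum>q\<in>pverts H. M (g, h) (p, q) * b q)"
      by (simp add: sum_distrib_right ab)
    also have "\<dots> = (\<Sum>q\<in>pverts H. (\<Sum>p\<in>pverts G. M (g, h) (p, q)) * b q)"
      by (subst sum.swap) (simp add: sum_distrib_right)
    also have "\<dots> = M (g, h) (g, h) * (\<Sum>q\<in>pverts H. b q)"
      using that by (simp add: col_sum_eq_diag sum_distrib_left)
    finally have "(of_nat (out_degree (with_proj G) g) :: complex) =
        of_nat (out_degree (with_proj H) h)"
      using that by (simp add: out_degree_eq_sum[OF G] out_degree_eq_sum[OF H] a_def b_def)
    then show ?thesis by simp
  qed
  have compatible: "M (p, h) (g, q) = 0"
    if mem: "g \<in> pverts G" "p \<in> pverts G" "q \<in> pverts H" "h \<in> pverts H"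
      and neq: "laplacian G g p \<noteq> laplacian H q h" for g p q h
  proof (cases "rel G p g = rel H h q")
    case True
    \<comment> \<open>Two adjacent pairs both give -1 and two distinct non-adjacent pairs both give
      0, so only equality remains. Arc symmetry bridges the opposite argument orders in
      \<open>rel\<close> and \<open>laplacian\<close>.\<close>
    then have "g = p" "q = h"
      using neq no_loop pair_graph_arcs_sym[OF G, of g p] pair_graph_arcs_sym[OF H, of q h]
      by (auto simp: laplacian_def rel_def split: if_splits)
    with neq no_loop have "out_degree (with_proj G) g \<noteq> out_degree (with_proj H) h"
      by (auto simp: laplacian_def)
    with degree[of g h] mem \<open>g = p\<close> \<open>q = h\<close> show ?thesis by auto
  next
    case False
    then show ?thesis
      using M_rel mem by blast
  qed
  show ?thesis
    using compatible
    by (intro cospectral_if_intertwine intertwine) (auto simp: laplacian_def)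
qed

theorem lemma5p4:
  fixes G :: "'a pair_pre_digraph" and H :: "'b pair_pre_digraph"
  assumes "pair_graph G" and "pair_graph H"
    and "G \<cong>\<^sub>S\<^sub>+ H"
  shows "cospectral (pverts G) (laplacian G) (pverts H) (laplacian H)
    \<and> cospectral (pverts (complement_graph G)) (laplacian (complement_graph G))
                    (pverts (complement_graph H)) (laplacian (complement_graph H))"
  using assms
  by (intro conjI cospectral_laplacian pair_graph_complement_graph psd_isomorphic_complement_graph)

end
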